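(* Let $\mathsf{k}$ be a field of characteristic $0$ and let $I$ be a non-principal monomial ideal of $R=\mathsf{k}[x,y]$. Let $\{x^{\beta_{11}}y^{\beta_{12}},\ldots,x^{\beta_{m1}}y^{\beta_{m2}}\}$ (with $m>1$) be the set of minimal monomial generators of $I$, labelled so that $\beta_{11}<\cdots<\beta_{m1}$ (and hence $\beta_{12}>\cdots>\beta_{m2}$). Let $i$ with $1\le i<m$ be an index such that $\beta_{(i+1)1}+\beta_{i2}=\max\{\beta_{(j+1)1}+\beta_{j2}\mid 1\le j<m\}$. Suppose that $\beta_{11}>0$ and $\beta_{m2}>0$, and set $N=\beta_{(i+1)1}+\beta_{i2}-\beta_{m2}-\beta_{11}$. Then, for every positive integer $n$, the differential power $I^{\langle n\rangle}$ is principal if and only if $n\ge N$.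
   Context: For a commutative $\mathsf{k}$-algebra $R$ and $P,Q\in\operatorname{End}_{\mathsf{k}}(R)$, put $[P,Q]=P\cdot Q-Q\cdot P$. Identify $a\in R$ with the endomorphism "multiplication by $a$". Let $D^0_{\mathsf{k}}(R)\subseteq \operatorname{End}_{\mathsf{k}}(R)$ be the set of multiplications by elements of $R$, and for $i>0$ let $D^i_{\mathsf{k}}(R)=\{\partial\in\operatorname{End}_{\mathsf{k}}(R)\mid [\partial,a]\in D^{i-1}_{\mathsf{k}}(R)\text{ for all }a\in R\}$. For an ideal $I\subseteq R$ and a positive integer $n$, the $n$-th differential power of $I$ is the ideal $I^{\langle n\rangle}=\{r\in R\mid \partial(r)\in I\text{ for all }\partial\in D^{n-1}_{\mathsf{k}}(R)\}$. *)

theory Defs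
  imports "HOL-Computational_Algebra.Polynomial"
begin

text \<open>
  Ideals of a commutative ring are its submodules as a module over itself, so
  the ideal generated by a set is its span with respect to multiplication.
\<close>

definition ideal_gen :: "'r::comm_ring_1 set \<Rightarrow> 'r set"
  where "ideal_gen = module.span (*)"

definition principal_ideal :: "'r::comm_ring_1 set \<Rightarrow> bool"
  where "principal_ideal J \<longleftrightarrow> (\<exists>g. J = ideal_gen {g})"

lemma module_times: "module ((*) :: 'r::comm_ring_1 \<Rightarrow> 'r \<Rightarrow> 'r)"
  by unfold_locales (simp_all add: algebra_simps)

lemma ideal_gen_singleton: "ideal_gen {g} = {f. g dvd f}"
  by (auto simp: ideal_gen_def module.span_singleton[OF module_times] dvd_def mult.commute)


text \<open>
  Differential operators on a commutative algebra \<open>'r\<close> over a field \<open>'k\<close>. The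
  algebra structure is given by the scalar multiplication \<open>s\<close>, and
  \<^term>\<open>Vector_Spaces.linear s s\<close> is membership in \<open>End\<^sub>k(R)\<close>.
\<close>

definition commutator :: "('r::ab_group_add \<Rightarrow> 'r) \<Rightarrow> ('r \<Rightarrow> 'r) \<Rightarrow> 'r \<Rightarrow> 'r"
  where "commutator P Q = (\<lambda>r. P (Q r) - Q (P r))"

primrec diff_ops :: "('k::field \<Rightarrow> 'r::comm_ring_1 \<Rightarrow> 'r) \<Rightarrow> nat \<Rightarrow> ('r \<Rightarrow> 'r) set" where
  "diff_ops s 0 = range (\<lambda>a. (*) a)"
| "diff_ops s (Suc i) =
     {P. Vector_Spaces.linear s s P \<and> (\<forall>a. commutator P ((*) a) \<in> diff_ops s i)}"

text \<open>Only meaningful for \<open>n > 0\<close>, because of the truncated subtraction.\<close>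

definition diff_power :: "('k::field \<Rightarrow> 'r::comm_ring_1 \<Rightarrow> 'r) \<Rightarrow> 'r set \<Rightarrow> nat \<Rightarrow> 'r set"
  where "diff_power s I n = {r. \<forall>P\<in>diff_ops s (n - 1). P r \<in> I}"


text \<open>
  The ring \<open>k[x,y]\<close> is represented as \<open>k[x][y]\<close>, i.e. by the type \<^typ>\<open>'k poly poly\<close>.
\<close>

definition X :: "'k::field poly poly"
  where "X = [:[:0, 1:]:]"

definition Y :: "'k::field poly poly"
  where "Y = [:0, 1:]"

definition scale :: "'k::field \<Rightarrow> 'k poly poly \<Rightarrow> 'k poly poly"
  where "scale c f = smult [:c:] f"

lemma vector_space_scale: "vector_space scale"
  by unfold_locales
     (simp_all add: scale_def smult_add_right smult_add_left [symmetric] mult.commute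
        flip: one_pCons)

lemma scale_mult_left: "scale c (f * g) = scale c f * g"
  by (simp add: scale_def)

lemma X_power_times_Y_power: "X ^ a * Y ^ b = monom (monom 1 a) b"
  by (simp add: X_def Y_def monom_altdef poly_const_pow)

definition monomials :: "'k::field poly poly set"
  where "monomials = {X ^ a * Y ^ b | a b. True}"

definition monomial_ideal :: "'k::field poly poly set \<Rightarrow> bool"
  where "monomial_ideal I \<longleftrightarrow> (\<exists>G \<subseteq> monomials. I = ideal_gen G)"

definition minimal_monomial_generators ::
    "'k::field poly poly set \<Rightarrow> 'k poly poly set \<Rightarrow> bool"
  where "minimal_monomial_generators I G \<longleftrightarrow>
    G \<subseteq> monomials \<and> ideal_gen G = I \<and> (\<forall>H. H \<subset> G \<longrightarrow> ideal_gen H \<noteq> I)"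

end

theory Submission imports Defs begin

text \<open>
  Write \<open>\<beta>\<^sub>j = (a\<^sub>j, b\<^sub>j)\<close> for the exponents of the generators and \<open>s = a\<^sub>1 + n - 1\<close>,
  \<open>t = b\<^sub>m + n - 1\<close>. Everything turns on the single monomial \<open>x\<^sup>s y\<^sup>t\<close>.

  Every element of \<open>I\<^sup>\<langle>\<^sup>n\<^sup>\<rangle>\<close> is divisible by \<open>x\<^sup>s y\<^sup>t\<close>: the partial derivatives
  \<open>\<partial>\<^sub>x\<^sup>c\<close> with \<open>c < n\<close> have order below \<open>n\<close>, so if some monomial of \<open>f\<close> had \<open>x\<close>-exponent less
  than \<open>s\<close>, then (in characteristic \<open>0\<close>) one of these derivatives would have a monomial with
  \<open>x\<close>-exponent below \<open>a\<^sub>1\<close>, which does not occur in \<open>I\<close>; here \<open>a\<^sub>1 > 0\<close> matters, since a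
  derivative can only lower an exponent to \<open>0\<close>. The same holds for \<open>y\<close>. On the other hand
  \<open>I\<^sup>\<langle>\<^sup>n\<^sup>\<rangle>\<close> contains \<open>x\<^sup>s y\<^sup>V\<close> and \<open>x\<^sup>U y\<^sup>t\<close> for large \<open>U\<close> and \<open>V\<close>. Since
  the greatest common divisor of these two is \<open>x\<^sup>s y\<^sup>t\<close>, the ideal \<open>I\<^sup>\<langle>\<^sup>n\<^sup>\<rangle>\<close> is
  principal if and only if it contains \<open>x\<^sup>s y\<^sup>t\<close>.

  Whether a monomial lies in \<open>I\<^sup>\<langle>\<^sup>n\<^sup>\<rangle>\<close> is decided by the operators
  \<open>\<partial>\<^sub>x\<^sup>c \<partial>\<^sub>y\<^sup>d\<close> with \<open>c + d < n\<close>: they are differential operators of order below \<open>n\<close>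
  (\<open>iterated_derivs_diff_ops\<close>), and conversely the commutator condition alone shows that an
  operator of order \<open>k\<close> lowers the exponents of a monomial by at most \<open>k\<close> in total
  (\<open>diff_ops_lower_exponents\<close>). Thus \<open>x\<^sup>s y\<^sup>t\<close> is in \<open>I\<^sup>\<langle>\<^sup>n\<^sup>\<rangle>\<close> iff \<open>x\<^sup>s\<^sup>-\<^sup>c y\<^sup>t\<^sup>-\<^sup>d \<in> I\<close> for all such
  \<open>c\<close>, \<open>d\<close>. As these exponents are at least \<open>a\<^sub>1\<close> and \<open>b\<^sub>m\<close>, such a monomial misses \<open>I\<close>
  exactly when it lies under an inner corner of the staircase, that is, has
  \<open>s - c < a\<^sub>j\<^sub>+\<^sub>1\<close> and \<open>t - d < b\<^sub>j\<close> for some \<open>j < m\<close>. The cheapest way to get there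
  takes \<open>c = n - (a\<^sub>j\<^sub>+\<^sub>1 - a\<^sub>1)\<close> and \<open>d = n - (b\<^sub>j - b\<^sub>m)\<close>, or \<open>0\<close> where
  this is negative, so it is possible with \<open>c + d < n\<close>
  iff \<open>n < (a\<^sub>j\<^sub>+\<^sub>1 - a\<^sub>1) + (b\<^sub>j - b\<^sub>m)\<close>. The largest of these bounds is \<open>N\<close>.
\<close>

section \<open>Ideals generated by a set\<close>

lemma ideal_gen_base: "g \<in> G \<Longrightarrow> g \<in> ideal_gen G"
  by (simp add: ideal_gen_def module.span_base[OF module_times])

lemma ideal_gen_zero: "0 \<in> ideal_gen G"
  by (simp add: ideal_gen_def module.span_zero[OF module_times])

lemma ideal_gen_mult: "f \<in> ideal_gen G \<Longrightarrow> c * f \<in> ideal_gen G"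
  by (simp add: ideal_gen_def module.span_scale[OF module_times])

lemma ideal_gen_add: "f \<in> ideal_gen G \<Longrightarrow> g \<in> ideal_gen G \<Longrightarrow> f + g \<in> ideal_gen G"
  by (simp add: ideal_gen_def module.span_add[OF module_times])

lemma ideal_gen_dvd: "f \<in> ideal_gen G \<Longrightarrow> f dvd g \<Longrightarrow> g \<in> ideal_gen G"
  by (metis dvd_def ideal_gen_mult mult.commute)

lemma ideal_gen_least:
  assumes "G \<subseteq> J" "0 \<in> J" "\<And>f g. f \<in> J \<Longrightarrow> g \<in> J \<Longrightarrow> f + g \<in> J" "\<And>c f. f \<in> J \<Longrightarrow> c * f \<in> J"
  shows "ideal_gen G \<subseteq> J"
  unfolding ideal_gen_def
  by (intro module.span_minimal[OF module_times] module.subspaceI[OF module_times] assms)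

text \<open>If \<open>g\<close> divided \<open>h\<close>, then \<open>h\<close> could be dropped from the generating set.\<close>

lemma minimal_generators_not_dvd:
  assumes min: "minimal_monomial_generators I G" and "g \<in> G" "h \<in> G" "g \<noteq> h"
  shows "\<not> g dvd h"
proof
  assume dvd: "g dvd h"
  let ?H = "G - {h}"
  have "g \<in> ideal_gen ?H"
    using assms by (intro ideal_gen_base) auto
  then have "h \<in> ideal_gen ?H"
    using dvd by (rule ideal_gen_dvd)
  then have "G \<subseteq> ideal_gen ?H"
    by (auto intro: ideal_gen_base)
  then have "ideal_gen G \<subseteq> ideal_gen ?H"
    by (rule ideal_gen_least) (auto intro: ideal_gen_zero ideal_gen_add ideal_gen_mult)
  moreover have "ideal_gen ?H \<subseteq> ideal_gen G"
    by (simp add: ideal_gen_def module.span_mono[OF module_times])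
  ultimately show False
    using min \<open>h \<in> G\<close> unfolding minimal_monomial_generators_def
    by (metis Diff_subset Diff_iff insertI1 psubsetI subset_antisym)
qed

section \<open>Differential operators on a commutative algebra\<close>

locale commutative_algebra = vector_space s
  for s :: "'k::field \<Rightarrow> 'r::comm_ring_1 \<Rightarrow> 'r" +
  assumes s_mult: "s c (f * g) = s c f * g"
begin

lemma linear_iff_additive_homogeneous:
  "Vector_Spaces.linear s s P \<longleftrightarrow>
    (\<forall>f g. P (f + g) = P f + P g) \<and> (\<forall>c f. P (s c f) = s c (P f))"
  using vector_space_axioms by (auto simp: Vector_Spaces.linear_iff)

lemma diff_ops_linear: "P \<in> diff_ops s k \<Longrightarrow> Vector_Spaces.linear s s P"
proof (cases k)
  case 0
  moreover have "a * s c f = s c (a * f)" for a c f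
    by (metis mult.commute s_mult)
  ultimately show "Vector_Spaces.linear s s P" if "P \<in> diff_ops s k"
    using that by (auto simp: linear_iff_additive_homogeneous distrib_left)
qed simp

lemma diff_ops_add:
  "P \<in> diff_ops s k \<Longrightarrow> Q \<in> diff_ops s k \<Longrightarrow> (\<lambda>f. P f + Q f) \<in> diff_ops s k"
proof (induction k arbitrary: P Q)
  case 0
  then obtain c d where "P = (*) c" "Q = (*) d"
    by auto
  then have "(\<lambda>f. P f + Q f) = (*) (c + d)"
    by (simp add: fun_eq_iff distrib_right)
  then show ?case
    by simp
next
  case (Suc k)
  have "commutator (\<lambda>f. P f + Q f) ((*) a) =
      (\<lambda>f. commutator P ((*) a) f + commutator Q ((*) a) f)" for a
    by (simp add: commutator_def algebra_simps)
  with Suc show ?case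
    by (auto simp: linear_iff_additive_homogeneous scale_right_distrib algebra_simps)
qed

lemma diff_ops_mult_left:
  "P \<in> diff_ops s k \<Longrightarrow> (\<lambda>f. c * P f) \<in> diff_ops s k"
proof (induction k arbitrary: P)
  case 0
  then obtain d where "P = (*) d"
    by auto
  then have "(\<lambda>f. c * P f) = (*) (c * d)"
    by (simp add: fun_eq_iff mult.assoc)
  then show ?case
    by simp
next
  case (Suc k)
  have "commutator (\<lambda>f. c * P f) ((*) a) = (\<lambda>f. c * commutator P ((*) a) f)" for a
    by (simp add: commutator_def algebra_simps)
  moreover have "c * s d f = s d (c * f)" for d f
    by (metis mult.commute s_mult)
  ultimately show ?case
    using Suc by (auto simp: linear_iff_additive_homogeneous algebra_simps)
qed

lemma diff_ops_Suc_mono: "P \<in> diff_ops s k \<Longrightarrow> P \<in> diff_ops s (Suc k)"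
proof (induction k arbitrary: P)
  case 0
  then obtain c where c: "P = (*) c"
    by auto
  have "commutator P ((*) a) = (*) 0" for a
    by (simp add: commutator_def c fun_eq_iff algebra_simps)
  with diff_ops_linear[OF 0] show ?case
    by (simp add: rangeI)
next
  case (Suc k)
  have "Vector_Spaces.linear s s P" "commutator P ((*) a) \<in> diff_ops s k" for a
    using Suc.prems by auto
  then show ?case
    using Suc.IH by (subst diff_ops.simps(2)) blast
qed

lemma diff_ops_mono: "P \<in> diff_ops s k \<Longrightarrow> k \<le> l \<Longrightarrow> P \<in> diff_ops s l"
  by (rule lift_Suc_mono_le[of "diff_ops s", THEN subsetD]) (use diff_ops_Suc_mono in blast)+

text \<open>
  A derivation raises the order by at most one because \<open>[d \<circ> P, a] = d \<circ> [P, a] + d(a) P\<close>.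
\<close>

lemma derivation_comp_diff_ops:
  assumes lin: "Vector_Spaces.linear s s d"
    and leibniz: "\<And>f g. d (f * g) = d f * g + f * d g"
    and P: "P \<in> diff_ops s k"
  shows "(\<lambda>f. d (P f)) \<in> diff_ops s (Suc k)"
  using P
proof (induction k arbitrary: P)
  have comp_lin: "Vector_Spaces.linear s s (\<lambda>f. d (P f))" if "P \<in> diff_ops s k" for P k
    using lin diff_ops_linear[OF that] by (simp add: linear_iff_additive_homogeneous)
  have diff: "d (f - g) = d f - d g" for f g
    using lin by (metis add_diff_cancel_right' diff_add_cancel linear_iff_additive_homogeneous)
  have comm: "commutator (\<lambda>f. d (P f)) ((*) a) =
      (\<lambda>f. d (commutator P ((*) a) f) + d a * P f)" for a P
    by (simp add: commutator_def diff leibniz)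
  {
    case 0
    then obtain c where c: "P = (*) c"
      by auto
    have "d 0 = 0"
      using diff[of 0 0] by simp
    then have "commutator (\<lambda>f. d (P f)) ((*) a) = (*) (d a * c)" for a
      by (simp add: comm) (simp add: c commutator_def algebra_simps fun_eq_iff)
    with comp_lin[OF 0] show ?case
      by simp
  next
    case (Suc k)
    have "commutator P ((*) a) \<in> diff_ops s k" for a
      using Suc.prems by simp
    then have "(\<lambda>f. d (commutator P ((*) a) f)) \<in> diff_ops s (Suc k)" for a
      by (rule Suc.IH)
    then have "commutator (\<lambda>f. d (P f)) ((*) a) \<in> diff_ops s (Suc k)" for a
      unfolding comm by (intro diff_ops_add diff_ops_mult_left Suc.prems)
    with comp_lin[OF Suc.prems] show ?case
      by (subst diff_ops.simps(2)) blast
  }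
qed

lemma derivation_funpow_diff_ops:
  assumes "Vector_Spaces.linear s s d" "\<And>f g. d (f * g) = d f * g + f * d g"
    and "P \<in> diff_ops s k"
  shows "(\<lambda>f. (d ^^ c) (P f)) \<in> diff_ops s (c + k)"
proof (induction c)
  case 0
  with assms(3) show ?case
    by simp
next
  case (Suc c)
  from derivation_comp_diff_ops[OF assms(1,2) Suc] show ?case
    by (simp del: diff_ops.simps)
qed

lemma id_diff_ops: "(\<lambda>f. f) \<in> diff_ops s 0"
  by (auto simp: image_iff fun_eq_iff intro!: exI[of _ 1])

end

text \<open>
  The identity \<open>P(x g) = x P(g) + [P, x](g)\<close> extracts one factor at a time: the first summand keeps
  it, the second gives it up together with one unit of the order. The extra factor \<open>h\<close> carries
  the factors already extracted, which keeps the induction inside one fixed ideal.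
\<close>

lemma diff_ops_lower_exponents:
  fixes x y :: "'r::comm_ring_1"
  assumes "P \<in> diff_ops s k"
    and "\<And>c d. c \<le> u \<Longrightarrow> d \<le> v \<Longrightarrow> c + d \<le> k \<Longrightarrow> h * (x ^ (u - c) * y ^ (v - d)) \<in> ideal_gen G"
  shows "h * P (x ^ u * y ^ v * g) \<in> ideal_gen G"
  using assms
proof (induction k arbitrary: P u v h)
  case 0
  then obtain a where "P = (*) a"
    by auto
  then have "h * P (x ^ u * y ^ v * g) = (a * g) * (h * (x ^ u * y ^ v))"
    by (simp add: mult_ac)
  moreover have "h * (x ^ u * y ^ v) \<in> ideal_gen G"
    using 0(2)[of 0 0] by simp
  ultimately show ?case
    by (simp add: ideal_gen_mult)
next
  case (Suc k)
  note lower_order = Suc.IH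
  have comm: "commutator P ((*) a) \<in> diff_ops s k" for a
    using Suc.prems(1) by simp
  have split: "h * P (a * w) = (h * a) * P w + h * commutator P ((*) a) w" for a w h
    by (simp add: commutator_def algebra_simps)
  from Suc.prems(2) show ?case
  proof (induction "u + v" arbitrary: u v h)
    case 0
    then have "h \<in> ideal_gen G"
      using "0.prems"[of 0 0] by simp
    then show ?case
      by (metis ideal_gen_mult mult.commute)
  next
    case (Suc l)
    show ?case
    proof (cases u)
      case u: (Suc u')
      have "(h * x) * P (x ^ u' * y ^ v * g) \<in> ideal_gen G"
      proof (rule Suc.hyps(1))
        show "l = u' + v"
          using Suc.hyps(2) u by simp
        show "h * x * (x ^ (u' - c) * y ^ (v - d)) \<in> ideal_gen G"
          if "c \<le> u'" "d \<le> v" "c + d \<le> Suc k" for c d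
          using Suc.prems[of c d] that u by (simp add: Suc_diff_le mult_ac)
      qed
      moreover have "h * commutator P ((*) x) (x ^ u' * y ^ v * g) \<in> ideal_gen G"
      proof (rule lower_order[OF comm])
        show "h * (x ^ (u' - c) * y ^ (v - d)) \<in> ideal_gen G"
          if "c \<le> u'" "d \<le> v" "c + d \<le> k" for c d
          using Suc.prems[of "Suc c" d] that u by simp
      qed
      ultimately have "h * P (x * (x ^ u' * y ^ v * g)) \<in> ideal_gen G"
        unfolding split by (rule ideal_gen_add)
      then show ?thesis
        by (simp add: u mult_ac)
    next
      case u: 0
      then obtain v' where v: "v = Suc v'"
        using Suc.hyps(2) by (cases v) auto
      have "(h * y) * P (x ^ u * y ^ v' * g) \<in> ideal_gen G"
      proof (rule Suc.hyps(1))
        show "l = u + v'"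
          using Suc.hyps(2) v by simp
        show "h * y * (x ^ (u - c) * y ^ (v' - d)) \<in> ideal_gen G"
          if "c \<le> u" "d \<le> v'" "c + d \<le> Suc k" for c d
          using Suc.prems[of c d] that v by (simp add: Suc_diff_le mult_ac)
      qed
      moreover have "h * commutator P ((*) y) (x ^ u * y ^ v' * g) \<in> ideal_gen G"
      proof (rule lower_order[OF comm])
        show "h * (x ^ (u - c) * y ^ (v' - d)) \<in> ideal_gen G"
          if "c \<le> u" "d \<le> v'" "c + d \<le> k" for c d
          using Suc.prems[of c "Suc d"] that v by simp
      qed
      ultimately have "h * P (y * (x ^ u * y ^ v' * g)) \<in> ideal_gen G"
        unfolding split by (rule ideal_gen_add)
      then show ?thesis
        by (simp add: v mult_ac)
    qed
  qed
qed

lemma monomial_multiple_in_diff_power: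
  assumes "n > 0"
    and "\<And>c d. c \<le> u \<Longrightarrow> d \<le> v \<Longrightarrow> c + d < n \<Longrightarrow> x ^ (u - c) * y ^ (v - d) \<in> ideal_gen G"
  shows "x ^ u * y ^ v * g \<in> diff_power s (ideal_gen G) n"
  unfolding diff_power_def
proof safe
  fix P assume "P \<in> diff_ops s (n - 1)"
  then have "1 * P (x ^ u * y ^ v * g) \<in> ideal_gen G"
    by (rule diff_ops_lower_exponents) (use assms in auto)
  then show "P (x ^ u * y ^ v * g) \<in> ideal_gen G"
    by simp
qed

section \<open>Partial derivatives on \<open>k[x,y]\<close>\<close>

interpretation poly2: commutative_algebra "scale :: 'k::field \<Rightarrow> 'k poly poly \<Rightarrow> _"
  by (intro commutative_algebra.intro vector_space_scale commutative_algebra_axioms.intro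
      scale_mult_left)

abbreviation deriv_x :: "'k::field poly poly \<Rightarrow> 'k poly poly"
  where "deriv_x \<equiv> map_poly pderiv"

abbreviation deriv_y :: "'k::field poly poly \<Rightarrow> 'k poly poly"
  where "deriv_y \<equiv> pderiv"

lemma pderiv_sum: "pderiv (sum f A) = (\<Sum>x\<in>A. pderiv (f x))"
  using higher_pderiv_sum[of 1 f A] by simp

lemma deriv_x_linear: "Vector_Spaces.linear scale scale deriv_x"
  by (auto simp: poly2.linear_iff_additive_homogeneous scale_def poly_eq_iff coeff_map_poly
      pderiv_add pderiv_smult)

lemma deriv_x_mult: "deriv_x (f * g) = deriv_x f * g + f * deriv_x g"
  by (intro poly_eqI)
    (simp add: coeff_map_poly coeff_mult pderiv_sum pderiv_mult sum.distrib
      mult.commute[of "pderiv _"] add.commute)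

lemma deriv_y_linear: "Vector_Spaces.linear scale scale deriv_y"
  by (auto simp: poly2.linear_iff_additive_homogeneous scale_def pderiv_add pderiv_smult)

lemma deriv_y_mult: "deriv_y (f * g) = deriv_y f * g + f * deriv_y g"
  by (simp add: pderiv_mult mult.commute)

lemma iterated_derivs_diff_ops:
  "(\<lambda>f. (deriv_x ^^ c) ((deriv_y ^^ d) f)) \<in> diff_ops scale (c + d)"
proof -
  have "deriv_y ^^ d \<in> diff_ops scale d"
    using poly2.derivation_funpow_diff_ops[OF deriv_y_linear deriv_y_mult poly2.id_diff_ops, of d]
    by simp
  with deriv_x_linear deriv_x_mult show ?thesis
    by (rule poly2.derivation_funpow_diff_ops)
qed

lemma diff_power_iterated_derivs:
  assumes "f \<in> diff_power scale I n" "c + d < n"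
  shows "(deriv_x ^^ c) ((deriv_y ^^ d) f) \<in> I"
proof -
  have "(\<lambda>f. (deriv_x ^^ c) ((deriv_y ^^ d) f)) \<in> diff_ops scale (n - 1)"
    using assms(2) by (intro poly2.diff_ops_mono[OF iterated_derivs_diff_ops]) simp
  moreover have "\<forall>P\<in>diff_ops scale (n - 1). P f \<in> I"
    using assms(1) by (simp add: diff_power_def)
  ultimately show ?thesis
    by (rule bspec[rotated])
qed

definition exponents :: "'k::field poly poly \<Rightarrow> (nat \<times> nat) set"
  where "exponents f = {(p, q). coeff (coeff f q) p \<noteq> 0}"

lemma exponents_monomial: "exponents (X ^ p * Y ^ q) = {(p, q)}"
  by (auto simp: exponents_def X_power_times_Y_power split: if_splits)

text \<open>
  Differentiating multiplies the shifted coefficients by rising factorials of positive integers,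
  which are nonzero in characteristic \<open>0\<close>.
\<close>

lemma exponents_iterated_derivs:
  fixes f :: "'k::field_char_0 poly poly"
  shows "(p, q) \<in> exponents ((deriv_x ^^ c) ((deriv_y ^^ d) f)) \<longleftrightarrow>
    (p + c, q + d) \<in> exponents f"
proof -
  have coeff_x: "coeff ((deriv_x ^^ c) g) q = (pderiv ^^ c) (coeff g q)" for g :: "'k poly poly"
    by (induction c) (simp_all add: coeff_map_poly)
  have "of_nat (pochhammer (Suc q) d) = [:of_nat (pochhammer (Suc q) d) :: 'k:]"
    by (rule of_nat_poly)
  then have "pochhammer (of_nat (Suc q)) d = [:pochhammer (of_nat (Suc q)) d :: 'k:]"
    unfolding pochhammer_of_nat .
  then have "coeff (coeff ((deriv_x ^^ c) ((deriv_y ^^ d) f)) q) p =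
      pochhammer (of_nat (Suc p)) c * (pochhammer (of_nat (Suc q)) d *
        coeff (coeff f (q + d)) (p + c))"
    by (simp only: coeff_x coeff_higher_pderiv) (simp add: ac_simps)
  moreover have "pochhammer (of_nat (Suc r)) e \<noteq> (0 :: 'k)" for r e
    unfolding pochhammer_of_nat of_nat_eq_0_iff using pochhammer_pos[of "Suc r" e] by simp
  ultimately show ?thesis
    unfolding exponents_def by (simp del: of_nat_Suc)
qed

section \<open>Monomial ideals\<close>

text \<open>
  The polynomials all of whose exponents lie in a fixed upward closed set form an ideal.
\<close>

lemma exponents_ideal_gen:
  fixes \<alpha> \<gamma> :: "'a \<Rightarrow> nat"
  assumes "f \<in> ideal_gen ((\<lambda>j. X ^ \<alpha> j * Y ^ \<gamma> j) ` J)" "(p, q) \<in> exponents f"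
  shows "\<exists>j\<in>J. \<alpha> j \<le> p \<and> \<gamma> j \<le> q"
proof -
  define U where "U = {(p, q). \<exists>j\<in>J. \<alpha> j \<le> p \<and> \<gamma> j \<le> q}"
  have "ideal_gen ((\<lambda>j. X ^ \<alpha> j * Y ^ \<gamma> j) ` J) \<subseteq> {f. exponents f \<subseteq> U}"
  proof (rule ideal_gen_least)
    show "(\<lambda>j. X ^ \<alpha> j * Y ^ \<gamma> j) ` J \<subseteq> {f. exponents f \<subseteq> U}"
      by (auto simp: exponents_monomial U_def)
    show "0 \<in> {f. exponents f \<subseteq> U}"
      by (simp add: exponents_def)
    show "f + g \<in> {f. exponents f \<subseteq> U}"
      if "f \<in> {f. exponents f \<subseteq> U}" "g \<in> {f. exponents f \<subseteq> U}" for f g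
      using that by (fastforce simp: exponents_def)
    show "h * f \<in> {f. exponents f \<subseteq> U}" if f: "f \<in> {f. exponents f \<subseteq> U}" for h f
    proof clarify
      fix p q assume "(p, q) \<in> exponents (h * f)"
      then have "(\<Sum>i\<le>q. coeff (coeff h i * coeff f (q - i)) p) \<noteq> 0"
        by (simp add: exponents_def coeff_mult coeff_sum)
      then obtain i where "i \<le> q" "coeff (coeff h i * coeff f (q - i)) p \<noteq> 0"
        by (auto elim: sum.not_neutral_contains_not_neutral)
      then obtain l where "coeff (coeff h i) l * coeff (coeff f (q - i)) (p - l) \<noteq> 0"
        unfolding coeff_mult by (auto elim: sum.not_neutral_contains_not_neutral)
      then have "(p - l, q - i) \<in> U"
        using f by (auto simp: exponents_def)
      then show "(p, q) \<in> U"
        unfolding U_def by (auto intro: order_trans[OF _ diff_le_self])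
    qed
  qed
  with assms show ?thesis
    by (auto simp: U_def)
qed

lemma monomial_dvd:
  assumes "p' \<le> p" "q' \<le> q"
  shows "X ^ p' * Y ^ q' dvd (X ^ p * Y ^ q :: 'k::field poly poly)"
  by (intro mult_dvd_mono le_imp_power_dvd assms)

lemma X_power: "X ^ u = [:monom 1 u:]"
  using X_power_times_Y_power[of u 0] by (simp add: monom_0)

lemma Y_power: "Y ^ v = monom 1 v"
  using X_power_times_Y_power[of 0 v] by (simp add: one_pCons[symmetric])

lemma monomial_dvd_iff:
  "X ^ u * Y ^ v dvd f \<longleftrightarrow> (\<forall>(p, q) \<in> exponents f. u \<le> p \<and> v \<le> q)"
proof
  assume "X ^ u * Y ^ v dvd f"
  then have "f \<in> ideal_gen ((\<lambda>j. X ^ u * Y ^ v) ` {()})"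
    by (simp add: ideal_gen_singleton)
  from exponents_ideal_gen[OF this] show "\<forall>(p, q) \<in> exponents f. u \<le> p \<and> v \<le> q"
    by blast
next
  assume exps: "\<forall>(p, q) \<in> exponents f. u \<le> p \<and> v \<le> q"
  have "coeff f q = 0" if "q < v" for q
    using exps that by (fastforce simp: exponents_def poly_eq_iff)
  then have "Y ^ v dvd f"
    by (simp add: Y_power monom_1_dvd_iff')
  then obtain g where g: "f = Y ^ v * g" ..
  have coeff_f: "coeff f (q + v) = coeff g q" for q
    by (simp add: g Y_power coeff_monom_mult)
  have "monom 1 u dvd coeff g q" for q
    unfolding monom_1_dvd_iff' coeff_f[symmetric] using exps by (fastforce simp: exponents_def)
  then have "X ^ u dvd g"
    by (simp add: X_power const_poly_dvd_iff)
  then have "X ^ u * Y ^ v dvd g * Y ^ v"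
    by (rule mult_dvd_mono[OF _ dvd_refl])
  then show "X ^ u * Y ^ v dvd f"
    by (simp add: g mult.commute)
qed

text \<open>
  As a divisor of a power of \<open>x\<close>, \<open>h\<close> has degree \<open>0\<close> in \<open>y\<close>, and so divides every
  coefficient in \<open>k[x]\<close> of \<open>y\<^sup>v\<close>, one of which is \<open>1\<close>.
\<close>

lemma dvd_X_power_and_Y_power_imp_unit:
  fixes h :: "'k::field poly poly"
  assumes "h dvd X ^ u" "h dvd Y ^ v"
  shows "h dvd 1"
proof -
  have "degree (X ^ u :: 'k poly poly) = 0" "X ^ u \<noteq> (0 :: 'k poly poly)"
    by (simp_all add: X_power)
  then have "degree h = 0"
    using dvd_imp_degree_le[OF assms(1)] by simp
  then obtain c where c: "h = [:c:]"
    by (rule degree_eq_zeroE)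
  have "c dvd coeff (Y ^ v) v"
    using assms(2) unfolding c const_poly_dvd_iff by blast
  also have "coeff (Y ^ v) v = (1 :: 'k poly)"
    by (simp add: Y_power)
  finally have "[:c:] dvd [:1:]"
    by simp
  then show ?thesis
    by (simp add: c one_pCons)
qed

text \<open>
  The cofactor \<open>h\<close> in \<open>g = x\<^sup>u y\<^sup>v h\<close> divides a power of \<open>x\<close> and a power of \<open>y\<close>, so it is a
  unit.
\<close>

lemma dvd_monomials_imp_dvd_gcd:
  fixes g :: "'k::field poly poly"
  assumes "X ^ u * Y ^ v dvd g" "g dvd X ^ u * Y ^ v'" "g dvd X ^ u' * Y ^ v"
    and "u \<le> u'" "v \<le> v'"
  shows "g dvd X ^ u * Y ^ v"
proof -
  have nz: "X ^ u * Y ^ v \<noteq> (0 :: 'k poly poly)"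
    by (simp add: X_def Y_def)
  obtain h where g: "g = X ^ u * Y ^ v * h"
    using assms(1) ..
  have "X ^ u * Y ^ v' = X ^ u * Y ^ v * (Y ^ (v' - v) :: 'k poly poly)"
    using \<open>v \<le> v'\<close> by (simp add: mult.assoc power_add[symmetric])
  then have "h dvd Y ^ (v' - v)"
    using assms(2) nz by (simp only: g dvd_mult_cancel_left simp_thms)
  moreover have "X ^ u' = X ^ u * (X ^ (u' - u) :: 'k poly poly)"
    using \<open>u \<le> u'\<close> by (simp add: power_add[symmetric])
  then have "X ^ u' * Y ^ v = X ^ u * Y ^ v * (X ^ (u' - u) :: 'k poly poly)"
    by (simp only: mult_ac)
  then have "h dvd X ^ (u' - u)"
    using assms(3) nz by (simp only: g dvd_mult_cancel_left simp_thms)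
  ultimately have "h dvd 1"
    using dvd_X_power_and_Y_power_imp_unit by blast
  then have "X ^ u * Y ^ v * h dvd X ^ u * Y ^ v * 1"
    by (rule mult_dvd_mono[OF dvd_refl])
  then show ?thesis
    by (simp add: g)
qed

text \<open>
  Differentiating \<open>min p (n - 1)\<close> times turns an \<open>x\<close>-exponent \<open>p\<close> into \<open>0\<close> or \<open>p - (n - 1)\<close>. The
  result occurs in an element of \<open>I\<close> and so is at least \<open>a\<close>; as \<open>a > 0\<close>, it is not \<open>0\<close>.
\<close>

lemma diff_power_monomial_dvd:
  fixes I :: "'k::field_char_0 poly poly set"
  assumes "\<And>f. f \<in> I \<Longrightarrow> X ^ a * Y ^ b dvd f" and "a > 0" "b > 0" "n > 0"
    and f: "f \<in> diff_power scale I n"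
  shows "X ^ (a + n - 1) * Y ^ (b + n - 1) dvd f"
  unfolding monomial_dvd_iff
proof clarify
  fix p q assume pq: "(p, q) \<in> exponents f"
  have bound: "a \<le> p - c \<and> b \<le> q - d" if "c + d < n" "c \<le> p" "d \<le> q" for c d
  proof -
    have "X ^ a * Y ^ b dvd (deriv_x ^^ c) ((deriv_y ^^ d) f)"
      using assms(1) diff_power_iterated_derivs[OF f that(1)] by blast
    moreover have "(p - c, q - d) \<in> exponents ((deriv_x ^^ c) ((deriv_y ^^ d) f))"
      using pq that by (simp add: exponents_iterated_derivs)
    ultimately show ?thesis
      unfolding monomial_dvd_iff by blast
  qed
  have "a \<le> p - min p (n - 1)" "b \<le> q - min q (n - 1)"
    using bound[of "min p (n - 1)" 0] bound[of 0 "min q (n - 1)"] \<open>n > 0\<close> by simp_all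
  then show "a + n - 1 \<le> p \<and> b + n - 1 \<le> q"
    using assms(2-4) by (auto simp: min_def split: if_splits)
qed

text \<open>
  A generator of \<open>J\<close> is squeezed: it is a multiple of \<open>x\<^sup>u y\<^sup>v\<close>, yet divides two monomials
  whose greatest common divisor is \<open>x\<^sup>u y\<^sup>v\<close>.
\<close>

lemma principal_ideal_iff_contains_gcd:
  fixes J :: "'k::field poly poly set"
  assumes dvd: "\<And>f. f \<in> J \<Longrightarrow> X ^ u * Y ^ v dvd f"
    and "X ^ u * Y ^ v' \<in> J" "X ^ u' * Y ^ v \<in> J" "u \<le> u'" "v \<le> v'"
  shows "principal_ideal J \<longleftrightarrow> (\<forall>g. X ^ u * Y ^ v * g \<in> J)"
proof
  assume "principal_ideal J"
  then obtain g where J: "J = {f. g dvd f}"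
    by (auto simp: principal_ideal_def ideal_gen_singleton)
  then have "g dvd X ^ u * Y ^ v"
    using assms by (intro dvd_monomials_imp_dvd_gcd[of u v g v' u']) auto
  then show "\<forall>g. X ^ u * Y ^ v * g \<in> J"
    by (simp add: J)
next
  assume "\<forall>g. X ^ u * Y ^ v * g \<in> J"
  then have "J = {f. X ^ u * Y ^ v dvd f}"
    using dvd by (auto simp: dvd_def)
  then show "principal_ideal J"
    unfolding principal_ideal_def ideal_gen_singleton by blast
qed

section \<open>The threshold for principality\<close>

text \<open>
  The points under the staircase with coordinates at least \<open>(a 1, b m)\<close> are those strictly below
  some inner corner \<open>(a (j + 1), b j)\<close>, and the condition for \<open>j\<close> says that fewer than \<open>n\<close>
  derivatives do not bring the candidate generator below that corner.
\<close>

lemma staircase_principal_diff_power_iff: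
  fixes a b :: "nat \<Rightarrow> nat" and m n :: nat
  defines "I \<equiv> ideal_gen ((\<lambda>j. X ^ a j * Y ^ b j) ` {1..m}) :: 'k::field_char_0 poly poly set"
  assumes m: "m > 1" and n: "n > 0" and pos: "a 1 > 0" "b m > 0"
    and a: "strict_mono_on {1..m} a" and b: "strict_antimono_on {1..m} b"
  shows "principal_ideal (diff_power scale I n) \<longleftrightarrow>
    (\<forall>j\<in>{1..<m}. a (j + 1) + b j \<le> n + a 1 + b m)"
proof -
  have a_less: "a j < a l" and b_less: "b l < b j" if "1 \<le> j" "j < l" "l \<le> m" for j l
    using that a b by (auto simp: monotone_on_def)
  have a_le: "a j \<le> a l" and b_le: "b l \<le> b j" if "1 \<le> j" "j \<le> l" "l \<le> m" for j l
    using that a_less[of j l] b_less[of j l] by (cases "j = l"; simp)+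
  have in_I: "X ^ p * Y ^ q \<in> I" if "j \<in> {1..m}" "a j \<le> p" "b j \<le> q" for p q j
    unfolding I_def
    by (rule ideal_gen_dvd[OF ideal_gen_base monomial_dvd]) (use that in auto)
  have I_exps: "\<exists>j\<in>{1..m}. a j \<le> p \<and> b j \<le> q" if "f \<in> I" "(p, q) \<in> exponents f" for f p q
    using that exponents_ideal_gen unfolding I_def by blast
  have I_dvd: "X ^ a 1 * Y ^ b m dvd f" if "f \<in> I" for f
    unfolding monomial_dvd_iff
  proof clarify
    fix p q assume "(p, q) \<in> exponents f"
    with that obtain j where j: "j \<in> {1..m}" "a j \<le> p" "b j \<le> q"
      using I_exps by blast
    then have "a 1 \<le> a j" "b m \<le> b j"
      using a_le[of 1 j] b_le[of j m] by auto
    with j show "a 1 \<le> p \<and> b m \<le> q"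
      by simp
  qed

  define J where "J = diff_power scale I n"
  define s where "s = a 1 + n - 1"
  define t where "t = b m + n - 1"
  have in_J: "X ^ u * Y ^ v * g \<in> J"
    if "\<And>c d. c \<le> u \<Longrightarrow> d \<le> v \<Longrightarrow> c + d < n \<Longrightarrow> X ^ (u - c) * Y ^ (v - d) \<in> I" for u v g
    using that n unfolding J_def I_def by (intro monomial_multiple_in_diff_power)
  have "principal_ideal J \<longleftrightarrow> (\<forall>g. X ^ s * Y ^ t * g \<in> J)"
  proof (rule principal_ideal_iff_contains_gcd)
    show "X ^ s * Y ^ t dvd f" if "f \<in> J" for f
      using diff_power_monomial_dvd[OF I_dvd pos n] that unfolding J_def s_def t_def by blast
    \<comment> \<open>An exponent of at least \<open>b 1 + n\<close> or \<open>a m + n\<close> stays above the whole staircase when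
      lowered fewer than \<open>n\<close> times, so the first or the last generator alone suffices.\<close>
    have "X ^ s * Y ^ (b 1 + n) * 1 \<in> J"
      by (rule in_J, rule in_I[of 1]) (use m in \<open>auto simp: s_def\<close>)
    then show "X ^ s * Y ^ (b 1 + n) \<in> J"
      by simp
    have "X ^ (a m + n) * Y ^ t * 1 \<in> J"
      by (rule in_J, rule in_I[of m]) (use m in \<open>auto simp: t_def\<close>)
    then show "X ^ (a m + n) * Y ^ t \<in> J"
      by simp
    show "s \<le> a m + n" "t \<le> b 1 + n"
      using a_le[of 1 m] b_le[of 1 m] m by (auto simp: s_def t_def)
  qed
  also have "\<dots> \<longleftrightarrow> (\<forall>j\<in>{1..<m}. a (j + 1) + b j \<le> n + a 1 + b m)"
  proof safe
    fix j assume "\<forall>g. X ^ s * Y ^ t * g \<in> J" and j: "j \<in> {1..<m}"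
    then have st: "X ^ s * Y ^ t \<in> J"
      by (metis mult.right_neutral)
    show "a (j + 1) + b j \<le> n + a 1 + b m"
    proof (rule ccontr)
      assume less: "\<not> a (j + 1) + b j \<le> n + a 1 + b m"
      \<comment> \<open>These are the least numbers of derivatives that bring both exponents under the corner
        \<open>(a (j + 1), b j)\<close>; truncation covers a direction that needs none.\<close>
      define c where "c = n + a 1 - a (j + 1)"
      define d where "d = n + b m - b j"
      have less': "a 1 < a (j + 1)" "b m < b j"
        using a_less[of 1 "j + 1"] b_less[of j m] j by auto
      then have cd: "c + d < n" "c \<le> s" "d \<le> t" "s - c < a (j + 1)" "t - d < b j"
        using less n by (auto simp: c_def d_def s_def t_def)
      have "(deriv_x ^^ c) ((deriv_y ^^ d) (X ^ s * Y ^ t)) \<in> I"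
        using st cd(1) unfolding J_def by (rule diff_power_iterated_derivs)
      moreover have "(s - c, t - d) \<in>
          exponents ((deriv_x ^^ c) ((deriv_y ^^ d) (X ^ s * Y ^ t :: 'k poly poly)))"
        using cd by (simp add: exponents_iterated_derivs exponents_monomial)
      ultimately obtain l where l: "l \<in> {1..m}" "a l \<le> s - c" "b l \<le> t - d"
        using I_exps by blast
      then have "a l < a (j + 1)" "b l < b j"
        using cd by auto
      then show False
        using a_le[of "j + 1" l] b_le[of l j] l(1) j by (cases "l \<le> j") auto
    qed
  next
    fix g assume bound: "\<forall>j\<in>{1..<m}. a (j + 1) + b j \<le> n + a 1 + b m"
    show "X ^ s * Y ^ t * g \<in> J"
    proof (rule in_J)
      fix c d assume cd: "c \<le> s" "d \<le> t" "c + d < n"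
      \<comment> \<open>Among the generators whose \<open>x\<close>-exponent fits, the last has the least \<open>y\<close>-exponent.\<close>
      define l where "l = Max {j\<in>{1..m}. a j \<le> s - c}"
      have "1 \<in> {j\<in>{1..m}. a j \<le> s - c}"
        using m cd by (auto simp: s_def)
      then have l: "l \<in> {j\<in>{1..m}. a j \<le> s - c}"
        unfolding l_def by (intro Max_in) auto
      have "b l \<le> t - d"
      proof (cases "l = m")
        case True
        then show ?thesis
          using cd by (simp add: t_def)
      next
        case False
        have "a (l + 1) > s - c"
        proof (rule ccontr)
          assume "\<not> a (l + 1) > s - c"
          then have "l + 1 \<in> {j\<in>{1..m}. a j \<le> s - c}"
            using l False by auto
          then have "l + 1 \<le> l"
            unfolding l_def by (intro Max_ge) auto
          then show False by simp
        qed
        moreover have "a (l + 1) + b l \<le> n + a 1 + b m"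
          using bound l False by auto
        ultimately show ?thesis
          using cd by (auto simp: s_def t_def)
      qed
      then show "X ^ (s - c) * Y ^ (t - d) \<in> I"
        using l by (intro in_I[of l]) auto
    qed
  qed
  finally show ?thesis
    unfolding J_def .
qed

theorem theorem4p3:
  fixes I :: "'k::field_char_0 poly poly set"
    and \<beta> :: "nat \<Rightarrow> nat \<Rightarrow> nat"
    and m i n :: nat
    and N :: int
  assumes "monomial_ideal I"
    and "\<not> principal_ideal I"
    and "m > 1"
    and "minimal_monomial_generators I ((\<lambda>j. X ^ \<beta> j 1 * Y ^ \<beta> j 2) ` {1..m})"
    and "strict_mono_on {1..m} (\<lambda>j. \<beta> j 1)"
    and "1 \<le> i" and "i < m"
    and "\<beta> (i + 1) 1 + \<beta> i 2 = Max ((\<lambda>j. \<beta> (j + 1) 1 + \<beta> j 2) ` {1..<m})"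
    and "\<beta> 1 1 > 0" and "\<beta> m 2 > 0"
    and "N = int (\<beta> (i + 1) 1) + int (\<beta> i 2) - int (\<beta> m 2) - int (\<beta> 1 1)"
    and "n > 0"
  shows "principal_ideal (diff_power scale I n) \<longleftrightarrow> int n \<ge> N"
proof -
  have I: "I = ideal_gen ((\<lambda>j. X ^ \<beta> j 1 * Y ^ \<beta> j 2) ` {1..m})"
    using assms(4) by (simp add: minimal_monomial_generators_def)
  \<comment> \<open>If the second exponents did not decrease, one generator would divide a later one.\<close>
  have "strict_antimono_on {1..m} (\<lambda>j. \<beta> j 2)"
  proof (rule monotone_onI, rule ccontr)
    fix j l assume jl: "j \<in> {1..m}" "l \<in> {1..m}" "j < l" "\<not> \<beta> l 2 < \<beta> j 2"
    have less: "\<beta> j 1 < \<beta> l 1"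
      using assms(5) jl by (auto simp: monotone_on_def)
    then have "exponents (X ^ \<beta> j 1 * Y ^ \<beta> j 2 :: 'k poly poly) \<noteq>
        exponents (X ^ \<beta> l 1 * Y ^ \<beta> l 2)"
      by (simp add: exponents_monomial)
    then have "\<not> X ^ \<beta> j 1 * Y ^ \<beta> j 2 dvd (X ^ \<beta> l 1 * Y ^ \<beta> l 2 :: 'k poly poly)"
      using jl by (intro minimal_generators_not_dvd[OF assms(4)]) auto
    then show False
      using less jl monomial_dvd[of "\<beta> j 1" "\<beta> l 1" "\<beta> j 2" "\<beta> l 2"] by auto
  qed
  then have "principal_ideal (diff_power scale I n) \<longleftrightarrow>
      (\<forall>j\<in>{1..<m}. \<beta> (j + 1) 1 + \<beta> j 2 \<le> n + \<beta> 1 1 + \<beta> m 2)"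
    unfolding I using assms by (intro staircase_principal_diff_power_iff)
  also have "\<dots> \<longleftrightarrow> Max ((\<lambda>j. \<beta> (j + 1) 1 + \<beta> j 2) ` {1..<m}) \<le> n + \<beta> 1 1 + \<beta> m 2"
    using assms(3) by (subst Max_le_iff) auto
  also have "\<dots> \<longleftrightarrow> int n \<ge> N"
    unfolding assms(8)[symmetric] assms(11) by linarith
  finally show ?thesis .
qed

end
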